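(* The Gromov–Hausdorff distance $d_{GH}$ is an extended pseudometric on any set of $\mathbb{R}$-filtrations of closure spaces.
   Context: A (Čech) closure space $(X,c)$ is a set $X$ with a function $c:2^X\to 2^X$ such that $c(\varnothing)=\varnothing$, $A\subset c(A)$, and $c(A\cup B)=c(A)\cup c(B)$. A map $f:(X,c_X)\to(Y,c_Y)$ is continuous if $f(c_X(A))\subset c_Y(f(A))$ for all $A\subset X$; $\mathbf{Cl}$ is the category of closure spaces and continuous maps (it is cocomplete; its monomorphisms are the injective continuous maps). An $\mathbb{R}$-filtration of closure spaces is a functor $X_\bullet:(\mathbb{R},\le)\to\mathbf{Cl}$ sending each $s\le t$ to a monomorphism; morphisms are natural transformations. It is an $\mathbb{R}$-filtered closure space if these maps are subset inclusions $X_s\subset X_t$; then write $X=\bigcup_tX_t$. Every $\mathbb{R}$-filtration $X_\bullet$ is isomorphic to an $\mathbb{R}$-filtered closure space $X'_\bullet$ obtained by choosing a colimit of $X_\bullet$ and letting $X'_t$ be the image of $X_t$ in it (with closure transported from $X_t$). A multivalued map $C:X\rightrightarrows Y$ is a subset $C\subset X\times Y$ projecting onto $X$; write $xCy$ for $(x,y)\in C$, $C(A)=\{y\mid\exists a\in A,\ aCy\}$. It is a correspondence if it also projects onto $Y$; $C^T=\{(y,x)\mid xCy\}$. A function $f:X\to Y$ is subordinate to $C$ if $xCf(x)$ for all $x$. For $\mathbb{R}$-filtered closure spaces and $\varepsilon\ge0$, a multivalued map $C:X\rightrightarrows Y$ is an $\varepsilon$-multivalued map if for all $t$: (1) $x\in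 X_t$ and $xCy$ imply $y\in Y_{t+\varepsilon}$; (2) for all $A\subset X_t$ and all $f$ subordinate to $C$, $C(c_{X_t}(A))\subset c_{Y_{t+\varepsilon}}(f(A))$. A correspondence $C$ is an $\varepsilon$-correspondence if $C$ and $C^T$ are $\varepsilon$-multivalued maps. $\mathrm{dist}(C)=\inf\{\varepsilon\ge0\mid C$ is an $\varepsilon$-correspondence$\}$ ($\infty$ if none). For $\mathbb{R}$-filtered closure spaces, $d_{GH}(X_\bullet,Y_\bullet)=\frac12\inf_C\mathrm{dist}(C)$ over all correspondences $C:X\rightrightarrows Y$ (the infimum of the empty set is $\infty$). For $\mathbb{R}$-filtrations, $d_{GH}(X_\bullet,Y_\bullet):=d_{GH}(X'_\bullet,Y'_\bullet)$ (well defined since $d_{GH}$ is isomorphism invariant). An extended pseudometric takes values in $[0,\infty]$, is symmetric, satisfies the triangle inequality, and vanishes on the diagonal. *)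

theory Defs
  imports "HOL-Library.Extended_Nonnegative_Real"
begin

section \<open>Closure spaces\<close>

text \<open>The closure operator is a total function on \<^typ>\<open>'a set\<close>; only its values on subsets of
  the carrier \<open>pts X\<close> carry meaning. Likewise maps matter only on the carrier of their source.\<close>

record 'a cspace =
  pts :: "'a set"
  cl :: "'a set \<Rightarrow> 'a set"

definition closure_space :: "'a cspace \<Rightarrow> bool" where
  "closure_space X \<longleftrightarrow>
     (\<forall>A\<subseteq>pts X. cl X A \<subseteq> pts X) \<and>
     cl X {} = {} \<and>
     (\<forall>A\<subseteq>pts X. A \<subseteq> cl X A) \<and>
     (\<forall>A\<subseteq>pts X. \<forall>B\<subseteq>pts X. cl X (A \<union> B) = cl X A \<union> cl X B)"

lemma closure_spaceD:
  assumes "closure_space X" "A \<subseteq> pts X"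
  shows "cl X A \<subseteq> pts X" "A \<subseteq> cl X A" "B \<subseteq> A \<Longrightarrow> cl X B \<subseteq> cl X A"
proof -
  show "cl X A \<subseteq> pts X" "A \<subseteq> cl X A" using assms by (simp_all add: closure_space_def)
  assume B: "B \<subseteq> A"
  have "cl X (B \<union> A) = cl X B \<union> cl X A"
    using assms B unfolding closure_space_def by (meson order_trans)
  then show "cl X B \<subseteq> cl X A" using B by (simp add: Un_absorb1 sup.absorb_iff2)
qed

definition cl_continuous :: "'a cspace \<Rightarrow> 'b cspace \<Rightarrow> ('a \<Rightarrow> 'b) \<Rightarrow> bool" where
  "cl_continuous X Y f \<longleftrightarrow>
     f ` pts X \<subseteq> pts Y \<and> (\<forall>A\<subseteq>pts X. f ` cl X A \<subseteq> cl Y (f ` A))"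

lemma cl_continuousD:
  assumes "cl_continuous X Y f"
  shows "x \<in> pts X \<Longrightarrow> f x \<in> pts Y" "A \<subseteq> pts X \<Longrightarrow> f ` cl X A \<subseteq> cl Y (f ` A)"
  using assms by (auto simp only: cl_continuous_def image_subset_iff)

text \<open>The monomorphisms of the category of closure spaces are the injective continuous maps;
  \<open>cl_mono_left_cancel\<close> and \<open>left_cancel_cl_mono\<close> below confirm this.\<close>

definition cl_mono :: "'a cspace \<Rightarrow> 'b cspace \<Rightarrow> ('a \<Rightarrow> 'b) \<Rightarrow> bool" where
  "cl_mono X Y f \<longleftrightarrow> cl_continuous X Y f \<and> inj_on f (pts X)"

lemma cl_mono_left_cancel:
  assumes "cl_mono X Y f" "cl_continuous W X g" "cl_continuous W X h"
    and "\<forall>w\<in>pts W. f (g w) = f (h w)"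
  shows "\<forall>w\<in>pts W. g w = h w"
proof
  fix w assume w: "w \<in> pts W"
  with assms(2,3) have "g w \<in> pts X" "h w \<in> pts X"
    by (simp_all add: cl_continuousD(1))
  with assms(1,4) w show "g w = h w"
    by (auto simp: cl_mono_def dest: inj_onD)
qed

lemma left_cancel_cl_mono:
  fixes X :: "'a cspace"
  assumes X: "closure_space X" and f: "cl_continuous X Y f"
    and canc: "\<And>(W :: unit cspace) g h. closure_space W \<Longrightarrow> cl_continuous W X g \<Longrightarrow>
      cl_continuous W X h \<Longrightarrow> \<forall>w\<in>pts W. f (g w) = f (h w) \<Longrightarrow> \<forall>w\<in>pts W. g w = h w"
  shows "cl_mono X Y f"
  unfolding cl_mono_def
proof (intro conjI f inj_onI)
  fix x y assume xy: "x \<in> pts X" "y \<in> pts X" "f x = f y"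
  let ?W = "\<lparr>pts = (UNIV :: unit set), cl = (\<lambda>A. A)\<rparr>"
  have W: "closure_space ?W" by (simp add: closure_space_def)
  have "cl_continuous ?W X (\<lambda>_. z)" if "z \<in> pts X" for z
    unfolding cl_continuous_def
  proof (intro conjI allI impI)
    fix A :: "unit set"
    show "(\<lambda>_. z) ` cl ?W A \<subseteq> cl X ((\<lambda>_. z) ` A)"
      using closure_spaceD(2)[OF X, of "(\<lambda>_. z) ` A"] that by (simp add: image_subset_iff)
  qed (use that in auto)
  from canc[OF W this[OF xy(1)] this[OF xy(2)]] show "x = y" using xy(3) by simp
qed

section \<open>Filtrations\<close>

text \<open>\<open>tmap X s t\<close> is the map \<open>X\<^sub>s \<rightarrow> X\<^sub>t\<close> and is relevant only for \<open>s \<le> t\<close>.\<close>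

record 'a filtration =
  obj :: "real \<Rightarrow> 'a cspace"
  tmap :: "real \<Rightarrow> real \<Rightarrow> 'a \<Rightarrow> 'a"

definition R_filtration :: "'a filtration \<Rightarrow> bool" where
  "R_filtration X \<longleftrightarrow>
     (\<forall>t. closure_space (obj X t)) \<and>
     (\<forall>s t. s \<le> t \<longrightarrow> cl_mono (obj X s) (obj X t) (tmap X s t)) \<and>
     (\<forall>t. \<forall>x\<in>pts (obj X t). tmap X t t x = x) \<and>
     (\<forall>r s t. r \<le> s \<and> s \<le> t \<longrightarrow>
        (\<forall>x\<in>pts (obj X r). tmap X s t (tmap X r s x) = tmap X r t x))"

definition R_filtered_cspace :: "(real \<Rightarrow> 'a cspace) \<Rightarrow> bool" where
  "R_filtered_cspace X \<longleftrightarrow>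
     (\<forall>t. closure_space (X t)) \<and>
     (\<forall>s t. s \<le> t \<longrightarrow> pts (X s) \<subseteq> pts (X t) \<and> cl_continuous (X s) (X t) (\<lambda>x. x))"

definition total_pts :: "(real \<Rightarrow> 'a cspace) \<Rightarrow> 'a set" where
  "total_pts X = (\<Union>t. pts (X t))"

subsection \<open>The filtered closure space of a filtration\<close>

text \<open>We choose the standard colimit: the quotient of the disjoint union of the \<open>X\<^sub>t\<close> that
  identifies points with a common image at some later time, with the final closure structure.\<close>

definition colim_rel :: "'a filtration \<Rightarrow> ((real \<times> 'a) \<times> (real \<times> 'a)) set" where
  "colim_rel X = {((s, x), (t, y)). x \<in> pts (obj X s) \<and> y \<in> pts (obj X t) \<and>
     (\<exists>u. s \<le> u \<and> t \<le> u \<and> tmap X s u x = tmap X t u y)}"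

definition colim_leg :: "'a filtration \<Rightarrow> real \<Rightarrow> 'a \<Rightarrow> (real \<times> 'a) set" where
  "colim_leg X t x = colim_rel X `` {(t, x)}"

definition colim :: "'a filtration \<Rightarrow> (real \<times> 'a) set cspace" where
  "colim X = \<lparr>pts = (SIGMA t:UNIV. pts (obj X t)) // colim_rel X,
     cl = (\<lambda>A. \<Union>t. colim_leg X t ` cl (obj X t) (colim_leg X t -` A \<inter> pts (obj X t)))\<rparr>"

text \<open>The closure on the image of \<open>X\<^sub>t\<close> is the one of \<open>X\<^sub>t\<close>, carried over along the injective leg;
  it is in general not the subspace closure of the colimit.\<close>

definition filtered_image :: "'a filtration \<Rightarrow> real \<Rightarrow> (real \<times> 'a) set cspace" where
  "filtered_image X t = \<lparr>pts = colim_leg X t ` pts (obj X t),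
     cl = (\<lambda>A. colim_leg X t ` cl (obj X t) (colim_leg X t -` A \<inter> pts (obj X t)))\<rparr>"

text \<open>The lemmas below confirm that this is a colimit, that its legs are injective, and that
  \<open>filtered_image X\<close> is a filtered closure space isomorphic to \<open>X\<close> by means of the legs.\<close>

lemma R_filtrationD:
  assumes "R_filtration X"
  shows "closure_space (obj X t)"
    and "s \<le> t \<Longrightarrow> cl_continuous (obj X s) (obj X t) (tmap X s t)"
    and "s \<le> t \<Longrightarrow> inj_on (tmap X s t) (pts (obj X s))"
  using assms by (simp_all add: R_filtration_def cl_mono_def)

lemma equiv_colim_rel:
  assumes X: "R_filtration X"
  shows "equiv (SIGMA t:UNIV. pts (obj X t)) (colim_rel X)"
proof (rule equivI)
  show "colim_rel X \<subseteq> (SIGMA t:UNIV. pts (obj X t)) \<times> (SIGMA t:UNIV. pts (obj X t))"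
    by (auto simp: colim_rel_def)
  show "refl_on (SIGMA t:UNIV. pts (obj X t)) (colim_rel X)"
    by (auto simp: refl_on_def colim_rel_def)
  show "sym (colim_rel X)"
    by (auto simp: sym_def colim_rel_def)
  show "Relation.trans (colim_rel X)"
  proof (rule transI)
    fix p q r assume "(p, q) \<in> colim_rel X" "(q, r) \<in> colim_rel X"
    moreover obtain a x b y c z where p: "p = (a, x)" "q = (b, y)" "r = (c, z)"
      by (metis surj_pair)
    ultimately obtain u v where x: "x \<in> pts (obj X a)" and y: "y \<in> pts (obj X b)"
      and z: "z \<in> pts (obj X c)" and u: "a \<le> u" "b \<le> u" "tmap X a u x = tmap X b u y"
      and v: "b \<le> v" "c \<le> v" "tmap X b v y = tmap X c v z"
      by (auto simp: colim_rel_def)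
    define w where "w = max u v"
    have fn: "tmap X s t (tmap X r s k) = tmap X r t k"
      if "r \<le> s" "s \<le> t" "k \<in> pts (obj X r)" for r s t k
      using X that unfolding R_filtration_def by blast
    have "tmap X a w x = tmap X u w (tmap X a u x)" using fn[of a u w x] u x w_def by simp
    also have "\<dots> = tmap X b w y" using fn[of b u w y] u y w_def by simp
    also have "\<dots> = tmap X v w (tmap X b v y)" using fn[of b v w y] v y w_def by simp
    also have "\<dots> = tmap X c w z" using fn[of c v w z] v z w_def by simp
    finally have "tmap X a w x = tmap X c w z" .
    moreover have "a \<le> w" "c \<le> w" using u v w_def by auto
    ultimately show "(p, r) \<in> colim_rel X" using x z unfolding p colim_rel_def by blast
  qed
qed

lemma colim_leg_eq_iff:
  assumes X: "R_filtration X" and "x \<in> pts (obj X s)" "y \<in> pts (obj X t)"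
  shows "colim_leg X s x = colim_leg X t y \<longleftrightarrow> ((s, x), (t, y)) \<in> colim_rel X"
  unfolding colim_leg_def
  using eq_equiv_class_iff[OF equiv_colim_rel[OF X]] assms by blast

lemma inj_on_colim_leg:
  assumes X: "R_filtration X"
  shows "inj_on (colim_leg X t) (pts (obj X t))"
proof (rule inj_onI)
  fix x y assume xy: "x \<in> pts (obj X t)" "y \<in> pts (obj X t)" "colim_leg X t x = colim_leg X t y"
  then obtain u where u: "t \<le> u" "tmap X t u x = tmap X t u y"
    using colim_leg_eq_iff[OF X] by (auto simp: colim_rel_def)
  moreover have "inj_on (tmap X t u) (pts (obj X t))"
    by (rule R_filtrationD(3)[OF X u(1)])
  ultimately show "x = y" using xy by (auto dest: inj_onD)
qed

lemma tmap_in: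
  assumes "R_filtration X" "s \<le> t" "x \<in> pts (obj X s)"
  shows "tmap X s t x \<in> pts (obj X t)"
  using R_filtrationD(2)[OF assms(1,2)] assms(3) by (rule cl_continuousD(1))

lemma colim_leg_tmap:
  assumes X: "R_filtration X" and st: "s \<le> t" and x: "x \<in> pts (obj X s)"
  shows "colim_leg X t (tmap X s t x) = colim_leg X s x"
proof -
  have "tmap X t t (tmap X s t x) = tmap X s t x"
    using X tmap_in[OF assms] by (simp add: R_filtration_def)
  then show ?thesis
    using st by (subst colim_leg_eq_iff[OF X tmap_in[OF assms] x])
      (auto simp: colim_rel_def tmap_in[OF assms] x)
qed

lemma pts_colim: "pts (colim X) = total_pts (filtered_image X)"
  by (auto simp: colim_def filtered_image_def total_pts_def quotient_def colim_leg_def)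

lemma leg_vimage_image:
  assumes X: "R_filtration X" and "B \<subseteq> pts (obj X t)"
  shows "colim_leg X t -` (colim_leg X t ` B) \<inter> pts (obj X t) = B"
  using inj_on_colim_leg[OF X, of t] assms(2) by (auto dest: inj_onD)

lemma closure_space_filtered_image:
  assumes X: "R_filtration X"
  shows "closure_space (filtered_image X t)"
proof -
  let ?l = "colim_leg X t" and ?P = "pts (obj X t)" and ?c = "cl (obj X t)"
  have cs: "closure_space (obj X t)" using X by (simp add: R_filtration_def)
  have sub: "?c B \<subseteq> ?P" "B \<subseteq> ?c B" if "B \<subseteq> ?P" for B
    by (fact closure_spaceD(1,2)[OF cs that])+
  have un: "?c (B \<union> D) = ?c B \<union> ?c D" if "B \<subseteq> ?P" "D \<subseteq> ?P" for B D
    using cs that by (simp add: closure_space_def)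
  have em: "?c {} = {}" using cs by (simp add: closure_space_def)
  have "A \<subseteq> ?l ` ?c (?l -` A \<inter> ?P)" if A: "A \<subseteq> ?l ` ?P" for A
  proof
    fix a assume "a \<in> A"
    then obtain x where "x \<in> ?l -` A \<inter> ?P" "a = ?l x" using A by auto
    then show "a \<in> ?l ` ?c (?l -` A \<inter> ?P)" using sub(2)[of "?l -` A \<inter> ?P"] by auto
  qed
  moreover have "?l ` ?c (?l -` A \<inter> ?P) \<subseteq> ?l ` ?P" for A
    using sub(1)[of "?l -` A \<inter> ?P"] by auto
  moreover have "?l ` ?c (?l -` (A \<union> B) \<inter> ?P) = ?l ` ?c (?l -` A \<inter> ?P) \<union> ?l ` ?c (?l -` B \<inter> ?P)" for A B
    using un[of "?l -` A \<inter> ?P" "?l -` B \<inter> ?P"] by (simp add: image_Un Int_Un_distrib2)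
  ultimately show ?thesis
    using em by (simp add: closure_space_def filtered_image_def del: vimage_Un)
qed

lemma filtered_image_iso:
  assumes X: "R_filtration X"
  shows "bij_betw (colim_leg X t) (pts (obj X t)) (pts (filtered_image X t))"
    and "B \<subseteq> pts (obj X t) \<Longrightarrow>
      cl (filtered_image X t) (colim_leg X t ` B) = colim_leg X t ` cl (obj X t) B"
proof -
  show "bij_betw (colim_leg X t) (pts (obj X t)) (pts (filtered_image X t))"
    using inj_on_colim_leg[OF X] by (simp add: filtered_image_def bij_betw_def)
  assume "B \<subseteq> pts (obj X t)"
  from leg_vimage_image[OF X this]
  show "cl (filtered_image X t) (colim_leg X t ` B) = colim_leg X t ` cl (obj X t) B"
    by (simp add: filtered_image_def)
qed

lemma R_filtered_cspace_filtered_image: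
  assumes X: "R_filtration X"
  shows "R_filtered_cspace (filtered_image X)"
  unfolding R_filtered_cspace_def
proof (intro conjI allI impI)
  show "closure_space (filtered_image X t)" for t by (rule closure_space_filtered_image[OF X])
next
  fix s t :: real assume st: "s \<le> t"
  show sub: "pts (filtered_image X s) \<subseteq> pts (filtered_image X t)"
    using colim_leg_tmap[OF X st, symmetric] tmap_in[OF X st]
    by (simp add: filtered_image_def image_subset_iff)
  have leg: "colim_leg X s ` D = colim_leg X t ` (tmap X s t ` D)" if "D \<subseteq> pts (obj X s)" for D
    unfolding image_image using colim_leg_tmap[OF X st] that by (intro image_cong) auto
  have "cl (filtered_image X s) A \<subseteq> cl (filtered_image X t) A"
    if A: "A \<subseteq> pts (filtered_image X s)" for A
  proof -
    obtain B where B: "B \<subseteq> pts (obj X s)" "A = colim_leg X s ` B"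
      using A by (auto simp: filtered_image_def subset_image_iff)
    have Bt: "tmap X s t ` B \<subseteq> pts (obj X t)" using B tmap_in[OF X st] by auto
    have At: "A = colim_leg X t ` (tmap X s t ` B)"
      using B leg by simp
    have cB: "cl (obj X s) B \<subseteq> pts (obj X s)"
      by (rule closure_spaceD(1)[OF R_filtrationD(1)[OF X] B(1)])
    have "cl (filtered_image X s) A = colim_leg X s ` cl (obj X s) B"
      using filtered_image_iso(2)[OF X B(1)] B(2) by simp
    also have "\<dots> = colim_leg X t ` (tmap X s t ` cl (obj X s) B)"
      by (rule leg[OF cB])
    also have "\<dots> \<subseteq> colim_leg X t ` cl (obj X t) (tmap X s t ` B)"
      using B(1) by (intro image_mono cl_continuousD(2)[OF R_filtrationD(2)[OF X st]])
    also have "\<dots> = cl (filtered_image X t) A"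
      using filtered_image_iso(2)[OF X Bt] At by simp
    finally show ?thesis .
  qed
  with sub show "cl_continuous (filtered_image X s) (filtered_image X t) (\<lambda>x. x)"
    by (auto simp: cl_continuous_def)
qed

lemma cl_colim: "cl (colim X) A = (\<Union>t. cl (filtered_image X t) (A \<inter> pts (filtered_image X t)))"
proof -
  have "colim_leg X t -` (A \<inter> colim_leg X t ` pts (obj X t)) \<inter> pts (obj X t)
      = colim_leg X t -` A \<inter> pts (obj X t)" for t by auto
  then show ?thesis by (simp add: colim_def filtered_image_def del: vimage_Int)
qed

lemma closure_space_colim:
  assumes X: "R_filtration X"
  shows "closure_space (colim X)"
proof -
  let ?F = "filtered_image X"
  have sub: "cl (?F t) A \<subseteq> pts (?F t)" "A \<subseteq> cl (?F t) A" if "A \<subseteq> pts (?F t)" for t A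
    by (fact closure_spaceD(1,2)[OF closure_space_filtered_image[OF X] that])+
  have un: "cl (?F t) ((A \<union> B) \<inter> pts (?F t)) =
      cl (?F t) (A \<inter> pts (?F t)) \<union> cl (?F t) (B \<inter> pts (?F t))" for t A B
    using closure_space_filtered_image[OF X, of t] by (simp add: closure_space_def Int_Un_distrib2)
  have em: "cl (?F t) {} = {}" for t
    using closure_space_filtered_image[OF X, of t] by (simp add: closure_space_def)
  show ?thesis
    unfolding closure_space_def pts_colim
  proof (intro conjI allI impI)
    fix A assume A: "A \<subseteq> total_pts ?F"
    show "cl (colim X) A \<subseteq> total_pts ?F"
      using sub(1)[of "A \<inter> pts (?F t)" t for t] by (fastforce simp: cl_colim total_pts_def)
    show "A \<subseteq> cl (colim X) A"
    proof
      fix a assume a: "a \<in> A"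
      then obtain t where "a \<in> A \<inter> pts (?F t)" using A by (auto simp: total_pts_def)
      then show "a \<in> cl (colim X) A" using sub(2)[of "A \<inter> pts (?F t)" t] by (auto simp: cl_colim)
    qed
  next
    fix A B assume "A \<subseteq> total_pts ?F" "B \<subseteq> total_pts ?F"
    show "cl (colim X) (A \<union> B) = cl (colim X) A \<union> cl (colim X) B"
      by (simp only: cl_colim un UN_Un_distrib)
  qed (simp add: cl_colim em)
qed

definition is_cocone :: "'a filtration \<Rightarrow> 'b cspace \<Rightarrow> (real \<Rightarrow> 'a \<Rightarrow> 'b) \<Rightarrow> bool" where
  "is_cocone X Z g \<longleftrightarrow> closure_space Z \<and> (\<forall>t. cl_continuous (obj X t) Z (g t)) \<and>
     (\<forall>s t. s \<le> t \<longrightarrow> (\<forall>x\<in>pts (obj X s). g t (tmap X s t x) = g s x))"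

lemma is_cocone_colim:
  assumes X: "R_filtration X"
  shows "is_cocone X (colim X) (colim_leg X)"
  unfolding is_cocone_def cl_continuous_def
proof (intro conjI allI impI ballI)
  show "closure_space (colim X)" by (rule closure_space_colim[OF X])
  show "colim_leg X t ` pts (obj X t) \<subseteq> pts (colim X)" for t
    by (auto simp: pts_colim total_pts_def filtered_image_def)
  show "colim_leg X t ` cl (obj X t) A \<subseteq> cl (colim X) (colim_leg X t ` A)"
    if "A \<subseteq> pts (obj X t)" for t A
  proof
    fix p assume "p \<in> colim_leg X t ` cl (obj X t) A"
    with leg_vimage_image[OF X that] have "p \<in> colim_leg X t ` cl (obj X t)
        (colim_leg X t -` colim_leg X t ` A \<inter> pts (obj X t))" by simp
    then show "p \<in> cl (colim X) (colim_leg X t ` A)" unfolding colim_def by simp blast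
  qed
  show "colim_leg X t (tmap X s t x) = colim_leg X s x"
    if "s \<le> t" "x \<in> pts (obj X s)" for s t x by (rule colim_leg_tmap[OF X that])
qed

lemma colim_universal:
  assumes X: "R_filtration X" and Z: "is_cocone X Z g"
  shows "\<exists>h. cl_continuous (colim X) Z h \<and> (\<forall>t. \<forall>x\<in>pts (obj X t). h (colim_leg X t x) = g t x)"
    and "\<lbrakk>\<forall>t. \<forall>x\<in>pts (obj X t). h (colim_leg X t x) = g t x;
          \<forall>t. \<forall>x\<in>pts (obj X t). k (colim_leg X t x) = g t x\<rbrakk> \<Longrightarrow> \<forall>p\<in>pts (colim X). h p = k p"
proof -
  define h where "h p = (let q = (SOME q. q \<in> p) in g (fst q) (snd q))" for p
  have h: "h (colim_leg X t x) = g t x" if x: "x \<in> pts (obj X t)" for t x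
  proof -
    define q where "q = (SOME q. q \<in> colim_leg X t x)"
    have "(t, x) \<in> colim_leg X t x" using x by (auto simp: colim_leg_def colim_rel_def)
    then have "q \<in> colim_leg X t x" unfolding q_def by (rule someI)
    then obtain s y u where q: "q = (s, y)" "y \<in> pts (obj X s)" "t \<le> u" "s \<le> u"
        "tmap X t u x = tmap X s u y"
      by (cases q) (auto simp: colim_leg_def colim_rel_def)
    have "g s y = g u (tmap X s u y)" using Z q by (auto simp: is_cocone_def)
    also have "\<dots> = g t x" using Z q x by (metis is_cocone_def)
    finally show ?thesis by (simp add: h_def q(1) flip: q_def)
  qed
  have Z': "closure_space Z" "cl_continuous (obj X t) Z (g t)" for t
    using Z by (simp_all add: is_cocone_def)
  have hZ: "h p \<in> pts Z" if p: "p \<in> pts (colim X)" for p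
  proof -
    obtain t x where "x \<in> pts (obj X t)" "p = colim_leg X t x"
      using p by (auto simp: pts_colim total_pts_def filtered_image_def)
    then show ?thesis using h cl_continuousD(1)[OF Z'(2)] by simp
  qed
  have "cl_continuous (colim X) Z h"
    unfolding cl_continuous_def
  proof (intro conjI allI impI)
    show "h ` pts (colim X) \<subseteq> pts Z"
      using hZ by auto
  next
    fix A assume A: "A \<subseteq> pts (colim X)"
    have hA: "h ` A \<subseteq> pts Z"
      using A hZ by auto
    have mono: "cl Z D \<subseteq> cl Z E" if "D \<subseteq> E" "E \<subseteq> pts Z" for D E
      by (rule closure_spaceD(3)[OF Z'(1) that(2,1)])
    show "h ` cl (colim X) A \<subseteq> cl Z (h ` A)"
    proof
      fix z assume "z \<in> h ` cl (colim X) A"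
      then obtain t x where x: "x \<in> cl (obj X t) (colim_leg X t -` A \<inter> pts (obj X t))"
          and z: "z = h (colim_leg X t x)" by (auto simp: colim_def)
      let ?B = "colim_leg X t -` A \<inter> pts (obj X t)"
      have "cl (obj X t) ?B \<subseteq> pts (obj X t)"
        by (rule closure_spaceD(1)[OF R_filtrationD(1)[OF X]]) simp
      then have "z = g t x" using x z h by auto
      moreover have "g t ` cl (obj X t) ?B \<subseteq> cl Z (g t ` ?B)"
        by (rule cl_continuousD(2)[OF Z'(2)]) simp
      ultimately have "z \<in> cl Z (g t ` ?B)" using x by blast
      moreover have "g t ` ?B \<subseteq> h ` A"
      proof
        fix w assume "w \<in> g t ` ?B"
        then obtain v where v: "v \<in> pts (obj X t)" "colim_leg X t v \<in> A" "w = g t v" by auto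
        then show "w \<in> h ` A" using h[OF v(1)] by (metis imageI)
      qed
      ultimately show "z \<in> cl Z (h ` A)" using mono[OF _ hA] by blast
    qed
  qed
  with h show "\<exists>h. cl_continuous (colim X) Z h \<and> (\<forall>t. \<forall>x\<in>pts (obj X t). h (colim_leg X t x) = g t x)"
    by blast
next
  assume "\<forall>t. \<forall>x\<in>pts (obj X t). h (colim_leg X t x) = g t x"
    "\<forall>t. \<forall>x\<in>pts (obj X t). k (colim_leg X t x) = g t x"
  then show "\<forall>p\<in>pts (colim X). h p = k p"
    by (auto simp: pts_colim total_pts_def filtered_image_def)
qed

section \<open>The Gromov--Hausdorff distance\<close>

definition multivalued_map :: "'a set \<Rightarrow> 'b set \<Rightarrow> ('a \<times> 'b) set \<Rightarrow> bool" where
  "multivalued_map X Y C \<longleftrightarrow> C \<subseteq> X \<times> Y \<and> Domain C = X"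

definition correspondence :: "'a set \<Rightarrow> 'b set \<Rightarrow> ('a \<times> 'b) set \<Rightarrow> bool" where
  "correspondence X Y C \<longleftrightarrow> multivalued_map X Y C \<and> Range C = Y"

definition subordinate :: "'a set \<Rightarrow> ('a \<times> 'b) set \<Rightarrow> ('a \<Rightarrow> 'b) \<Rightarrow> bool" where
  "subordinate X C f \<longleftrightarrow> (\<forall>x\<in>X. (x, f x) \<in> C)"

definition eps_multivalued_map ::
  "real \<Rightarrow> (real \<Rightarrow> 'a cspace) \<Rightarrow> (real \<Rightarrow> 'b cspace) \<Rightarrow> ('a \<times> 'b) set \<Rightarrow> bool" where
  "eps_multivalued_map \<epsilon> X Y C \<longleftrightarrow>
     multivalued_map (total_pts X) (total_pts Y) C \<and>
     (\<forall>t. (\<forall>x y. x \<in> pts (X t) \<and> (x, y) \<in> C \<longrightarrow> y \<in> pts (Y (t + \<epsilon>))) \<and>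
          (\<forall>A f. A \<subseteq> pts (X t) \<and> subordinate (total_pts X) C f \<longrightarrow>
             C `` cl (X t) A \<subseteq> cl (Y (t + \<epsilon>)) (f ` A)))"

definition eps_correspondence ::
  "real \<Rightarrow> (real \<Rightarrow> 'a cspace) \<Rightarrow> (real \<Rightarrow> 'b cspace) \<Rightarrow> ('a \<times> 'b) set \<Rightarrow> bool" where
  "eps_correspondence \<epsilon> X Y C \<longleftrightarrow>
     correspondence (total_pts X) (total_pts Y) C \<and>
     eps_multivalued_map \<epsilon> X Y C \<and> eps_multivalued_map \<epsilon> Y X (C\<inverse>)"

definition distortion ::
  "(real \<Rightarrow> 'a cspace) \<Rightarrow> (real \<Rightarrow> 'b cspace) \<Rightarrow> ('a \<times> 'b) set \<Rightarrow> ennreal" where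
  "distortion X Y C = (INF \<epsilon>\<in>{\<epsilon>. 0 \<le> \<epsilon> \<and> eps_correspondence \<epsilon> X Y C}. ennreal \<epsilon>)"

definition dGH_filtered :: "(real \<Rightarrow> 'a cspace) \<Rightarrow> (real \<Rightarrow> 'b cspace) \<Rightarrow> ennreal" where
  "dGH_filtered X Y =
     (INF C\<in>{C. correspondence (total_pts X) (total_pts Y) C}. distortion X Y C) / 2"

definition dGH :: "'a filtration \<Rightarrow> 'b filtration \<Rightarrow> ennreal" where
  "dGH X Y = dGH_filtered (filtered_image X) (filtered_image Y)"

definition extended_pseudometric_on :: "'a set \<Rightarrow> ('a \<Rightarrow> 'a \<Rightarrow> ennreal) \<Rightarrow> bool" where
  "extended_pseudometric_on S d \<longleftrightarrow>
     (\<forall>x\<in>S. d x x = 0) \<and>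
     (\<forall>x\<in>S. \<forall>y\<in>S. d x y = d y x) \<and>
     (\<forall>x\<in>S. \<forall>y\<in>S. \<forall>z\<in>S. d x z \<le> d x y + d y z)"

end

theory Submission
  imports Defs
begin

text \<open>The triangle inequality rests on composing an \<open>\<epsilon>\<close>-correspondence \<open>C\<close> with a
  \<open>\<delta>\<close>-correspondence \<open>D\<close>. A function \<open>h\<close> subordinate to the composite need not factor as \<open>g \<circ> f\<close>
  with \<open>f\<close> subordinate to \<open>C\<close> and \<open>g\<close> to \<open>D\<close>. But for fixed \<open>A\<close> one can choose \<open>f\<close> through the
  intermediate points and then \<open>g\<close> on \<open>f ` A\<close> by picking one preimage in \<open>A\<close> for each point, so that
  \<open>g ` f ` A \<subseteq> h ` A\<close>; monotonicity of the closure makes this sufficient.\<close>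

lemma filtered_closure_space: "R_filtered_cspace X \<Longrightarrow> closure_space (X t)"
  by (simp add: R_filtered_cspace_def)

lemma eps_multivalued_mapD:
  assumes "eps_multivalued_map \<epsilon> X Y C"
  shows "C \<subseteq> total_pts X \<times> total_pts Y" "Domain C = total_pts X"
    and "x \<in> pts (X t) \<Longrightarrow> (x, y) \<in> C \<Longrightarrow> y \<in> pts (Y (t + \<epsilon>))"
    and "A \<subseteq> pts (X t) \<Longrightarrow> subordinate (total_pts X) C f \<Longrightarrow>
           C `` cl (X t) A \<subseteq> cl (Y (t + \<epsilon>)) (f ` A)"
  using assms unfolding eps_multivalued_map_def multivalued_map_def by blast+

lemma eps_multivalued_map_Id_on:
  assumes "R_filtered_cspace X"
  shows "eps_multivalued_map 0 X X (Id_on (total_pts X))"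
proof -
  have "Id_on (total_pts X) `` cl (X t) A \<subseteq> cl (X t) (f ` A)"
    if A: "A \<subseteq> pts (X t)" and f: "subordinate (total_pts X) (Id_on (total_pts X)) f" for t A f
  proof -
    \<comment> \<open>The identity is the only function subordinate to the diagonal, so every
      admissible \<open>f\<close> fixes \<open>A\<close>.\<close>
    have "f x = x" if "x \<in> A" for x
      using f A that unfolding subordinate_def total_pts_def by auto
    then have "f ` A = A" by force
    then show ?thesis by auto
  qed
  then show ?thesis
    by (auto simp: eps_multivalued_map_def multivalued_map_def)
qed

lemma eps_correspondence_Id_on:
  "R_filtered_cspace X \<Longrightarrow> eps_correspondence 0 X X (Id_on (total_pts X))"
  using eps_multivalued_map_Id_on[of X]
  by (auto simp: eps_correspondence_def correspondence_def eps_multivalued_map_def)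

lemma eps_correspondence_converse:
  "eps_correspondence \<epsilon> X Y C \<Longrightarrow> eps_correspondence \<epsilon> Y X (C\<inverse>)"
  by (auto simp: eps_correspondence_def correspondence_def multivalued_map_def)

lemma subordinate_relcomp_factor:
  assumes h: "subordinate X (C O D) h" and A: "A \<subseteq> X" and Y: "Y \<subseteq> Domain D"
  obtains f g where "subordinate X C f" "subordinate Y D g" "g ` f ` A \<subseteq> h ` A"
proof -
  have "\<forall>x\<in>X. \<exists>y. (x, y) \<in> C \<and> (y, h x) \<in> D"
    using h unfolding subordinate_def by blast
  then obtain f where f: "\<And>x. x \<in> X \<Longrightarrow> (x, f x) \<in> C \<and> (f x, h x) \<in> D"
    by metis
  \<comment> \<open>The image of \<open>A\<close> is adjoined because it is not known to lie in
    \<open>Y\<close>. A point \<open>f x\<close> with \<open>x\<close> in \<open>A\<close> is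
    related by \<open>D\<close> to \<open>h x\<close>, which supplies a value in the image of
    \<open>A\<close> under \<open>h\<close>.\<close>
  have "\<forall>y\<in>Y \<union> f ` A. \<exists>z. (y, z) \<in> D \<and> (y \<in> f ` A \<longrightarrow> z \<in> h ` A)"
    using f A Y by blast
  then obtain g where "\<And>y. y \<in> Y \<union> f ` A \<Longrightarrow> (y, g y) \<in> D \<and> (y \<in> f ` A \<longrightarrow> g y \<in> h ` A)"
    by metis
  with f that[of f g] show thesis unfolding subordinate_def by blast
qed

lemma eps_multivalued_map_relcomp:
  assumes X: "R_filtered_cspace X" and Z: "R_filtered_cspace Z"
    and C: "eps_multivalued_map \<epsilon> X Y C" and D: "eps_multivalued_map \<delta> Y Z D"
  shows "eps_multivalued_map (\<epsilon> + \<delta>) X Z (C O D)"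
proof -
  note C = eps_multivalued_mapD[OF C] and D = eps_multivalued_mapD[OF D]
  have pt: "z \<in> pts (Z (t + (\<epsilon> + \<delta>)))" if x: "x \<in> pts (X t)" and xz: "(x, z) \<in> C O D" for t x z
  proof -
    obtain y where "(x, y) \<in> C" "(y, z) \<in> D" using xz by blast
    then show ?thesis using D(3)[of y "t + \<epsilon>" z] C(3) x by (simp add: add.assoc)
  qed
  moreover have "(C O D) `` cl (X t) A \<subseteq> cl (Z (t + (\<epsilon> + \<delta>))) (h ` A)"
    if A: "A \<subseteq> pts (X t)" and h: "subordinate (total_pts X) (C O D) h" for t A h
  proof -
    have AX: "A \<subseteq> total_pts X" using A by (auto simp: total_pts_def)
    obtain f g where f: "subordinate (total_pts X) C f" and g: "subordinate (total_pts Y) D g"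
      and gf: "g ` f ` A \<subseteq> h ` A"
      using subordinate_relcomp_factor[OF h AX, of "total_pts Y"] D(2) by blast
    \<comment> \<open>This allows the closure condition of \<open>D\<close> to be applied at time
      \<open>t + \<epsilon>\<close>.\<close>
    have fA: "f ` A \<subseteq> pts (Y (t + \<epsilon>))"
      using C(3) A AX f unfolding subordinate_def by blast
    \<comment> \<open>Monotonicity of the closure is available only below a subset of the
      carrier.\<close>
    have hA: "h ` A \<subseteq> pts (Z (t + (\<epsilon> + \<delta>)))"
      using pt A AX h unfolding subordinate_def by blast
    have "(C O D) `` cl (X t) A = D `` (C `` cl (X t) A)" by blast
    also have "\<dots> \<subseteq> D `` cl (Y (t + \<epsilon>)) (f ` A)"
      using C(4)[OF A f] by blast
    also have "\<dots> \<subseteq> cl (Z (t + (\<epsilon> + \<delta>))) (g ` f ` A)"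
      using D(4)[OF fA g] by (simp add: add.assoc)
    also have "\<dots> \<subseteq> cl (Z (t + (\<epsilon> + \<delta>))) (h ` A)"
      by (rule closure_spaceD(3)[OF filtered_closure_space[OF Z] hA gf])
    finally show ?thesis .
  qed
  moreover have "multivalued_map (total_pts X) (total_pts Z) (C O D)"
    using C(1,2) D(1,2) unfolding multivalued_map_def by blast
  ultimately show ?thesis unfolding eps_multivalued_map_def by blast
qed

text \<open>The converse of \<open>C O D\<close> is \<open>D\<inverse> O C\<inverse>\<close>, so the
  composition lemma also covers the backward direction, with the two bounds in the opposite
  order.\<close>

lemma eps_correspondence_relcomp:
  assumes "R_filtered_cspace X" "R_filtered_cspace Z"
    and C: "eps_correspondence \<epsilon> X Y C" and D: "eps_correspondence \<delta> Y Z D"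
  shows "eps_correspondence (\<epsilon> + \<delta>) X Z (C O D)"
proof -
  have "eps_multivalued_map (\<epsilon> + \<delta>) X Z (C O D)"
    using assms eps_multivalued_map_relcomp unfolding eps_correspondence_def by blast
  moreover have "eps_multivalued_map (\<epsilon> + \<delta>) Z X ((C O D)\<inverse>)"
    using assms eps_multivalued_map_relcomp[of Z X \<delta> Y "D\<inverse>" \<epsilon> "C\<inverse>"]
    unfolding eps_correspondence_def by (simp add: converse_relcomp add.commute)
  moreover have "Range (C O D) = total_pts Z"
    using C D unfolding eps_correspondence_def correspondence_def multivalued_map_def by blast
  ultimately show ?thesis
    unfolding eps_correspondence_def correspondence_def eps_multivalued_map_def by blast
qed

text \<open>Merges the nested infima into one over real numbers, so that symmetry and the triangle
  inequality reduce to operations on admissible bounds. If there are none, both sides are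
  \<open>top\<close>.\<close>

lemma dGH_filtered_eq_INF:
  "dGH_filtered X Y = (INF \<epsilon>\<in>{\<epsilon>. 0 \<le> \<epsilon> \<and> (\<exists>C. eps_correspondence \<epsilon> X Y C)}. ennreal \<epsilon>) / 2"
proof -
  have "(INF C\<in>{C. correspondence (total_pts X) (total_pts Y) C}. distortion X Y C) =
    (INF \<epsilon>\<in>{\<epsilon>. 0 \<le> \<epsilon> \<and> (\<exists>C. eps_correspondence \<epsilon> X Y C)}. ennreal \<epsilon>)"
  proof (intro antisym INF_greatest)
    fix \<epsilon> assume "\<epsilon> \<in> {\<epsilon>. 0 \<le> \<epsilon> \<and> (\<exists>C. eps_correspondence \<epsilon> X Y C)}"
    then obtain C where "0 \<le> \<epsilon>" and C: "eps_correspondence \<epsilon> X Y C" by blast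
    then have "distortion X Y C \<le> ennreal \<epsilon>"
      unfolding distortion_def by (intro INF_lower) simp
    moreover have "correspondence (total_pts X) (total_pts Y) C"
      using C by (simp add: eps_correspondence_def)
    ultimately show "(INF C\<in>{C. correspondence (total_pts X) (total_pts Y) C}. distortion X Y C)
        \<le> ennreal \<epsilon>"
      by (intro INF_lower2) auto
  next
    fix C
    show "(INF \<epsilon>\<in>{\<epsilon>. 0 \<le> \<epsilon> \<and> (\<exists>C. eps_correspondence \<epsilon> X Y C)}. ennreal \<epsilon>) \<le> distortion X Y C"
      unfolding distortion_def by (intro INF_superset_mono) auto
  qed
  then show ?thesis by (simp add: dGH_filtered_def)
qed

lemma dGH_filtered_refl:
  assumes "R_filtered_cspace X"
  shows "dGH_filtered X X = 0"
proof -
  have "(INF \<epsilon>\<in>{\<epsilon>. 0 \<le> \<epsilon> \<and> (\<exists>C. eps_correspondence \<epsilon> X X C)}. ennreal \<epsilon>) \<le> ennreal 0"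
    using eps_correspondence_Id_on[OF assms] by (intro INF_lower) auto
  then show ?thesis by (simp add: dGH_filtered_eq_INF)
qed

text \<open>Converses turn correspondences in one direction into ones in the other with the same
  bound, so the two infima range over the same set.\<close>

lemma dGH_filtered_commute: "dGH_filtered X Y = dGH_filtered Y X"
proof -
  have "(\<exists>C. eps_correspondence \<epsilon> X Y C) = (\<exists>C. eps_correspondence \<epsilon> Y X C)" for \<epsilon>
    by (blast intro: eps_correspondence_converse)
  then show ?thesis by (simp add: dGH_filtered_eq_INF)
qed

text \<open>Choose near-minimisers of \<open>f\<close> and \<open>g\<close>, each within half of an
  arbitrary \<open>e\<close>. If \<open>A\<close> or \<open>B\<close> is empty the right side is
  \<open>top\<close>, a case absorbed by \<open>ennreal_le_epsilon\<close>.\<close>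

lemma INF_ennreal_subadditive:
  assumes "\<And>a b. \<lbrakk>a \<in> A; b \<in> B\<rbrakk> \<Longrightarrow> \<exists>c\<in>C. h c \<le> f a + (g b :: ennreal)"
  shows "(INF c\<in>C. h c) \<le> (INF a\<in>A. f a) + (INF b\<in>B. g b)"
proof (rule ennreal_le_epsilon)
  fix e :: real
  assume fin: "(INF a\<in>A. f a) + (INF b\<in>B. g b) < top" and e: "0 < e"
  \<comment> \<open>Strictness fails at \<open>top\<close>, hence the use of \<open>fin\<close> for
    both infima.\<close>
  have near: "x < x + ennreal (e / 2)" if "x < top" for x
    using ennreal_add_left_cancel_less[of x 0 "ennreal (e / 2)"] that e by auto
  obtain a where a: "a \<in> A" "f a < (INF a\<in>A. f a) + ennreal (e / 2)"
    using near[of "INF a\<in>A. f a"] fin by (auto simp: INF_less_iff)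
  obtain b where b: "b \<in> B" "g b < (INF b\<in>B. g b) + ennreal (e / 2)"
    using near[of "INF b\<in>B. g b"] fin by (auto simp: INF_less_iff)
  obtain c where c: "c \<in> C" "h c \<le> f a + g b" using assms a(1) b(1) by blast
  have "(INF c\<in>C. h c) \<le> f a + g b" using c by (rule INF_lower2)
  also have "\<dots> \<le> ((INF a\<in>A. f a) + ennreal (e / 2)) + ((INF b\<in>B. g b) + ennreal (e / 2))"
    using a b by (intro add_mono) auto
  also have "\<dots> = (INF a\<in>A. f a) + (INF b\<in>B. g b) + (ennreal (e / 2) + ennreal (e / 2))"
    by (simp only: ac_simps)
  also have "ennreal (e / 2) + ennreal (e / 2) = ennreal e"
    using e by (simp flip: ennreal_plus)
  finally show "(INF c\<in>C. h c) \<le> (INF a\<in>A. f a) + (INF b\<in>B. g b) + ennreal e" .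
qed

lemma dGH_filtered_triangle:
  assumes "R_filtered_cspace X" "R_filtered_cspace Z"
  shows "dGH_filtered X Z \<le> dGH_filtered X Y + dGH_filtered Y Z"
proof -
  have "(INF \<epsilon>\<in>{\<epsilon>. 0 \<le> \<epsilon> \<and> (\<exists>C. eps_correspondence \<epsilon> X Z C)}. ennreal \<epsilon>) \<le>
      (INF \<epsilon>\<in>{\<epsilon>. 0 \<le> \<epsilon> \<and> (\<exists>C. eps_correspondence \<epsilon> X Y C)}. ennreal \<epsilon>) +
      (INF \<epsilon>\<in>{\<epsilon>. 0 \<le> \<epsilon> \<and> (\<exists>C. eps_correspondence \<epsilon> Y Z C)}. ennreal \<epsilon>)"
  proof (rule INF_ennreal_subadditive)
    fix \<epsilon> \<delta>
    assume "\<epsilon> \<in> {\<epsilon>. 0 \<le> \<epsilon> \<and> (\<exists>C. eps_correspondence \<epsilon> X Y C)}"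
      and "\<delta> \<in> {\<epsilon>. 0 \<le> \<epsilon> \<and> (\<exists>C. eps_correspondence \<epsilon> Y Z C)}"
    then show "\<exists>\<gamma>\<in>{\<epsilon>. 0 \<le> \<epsilon> \<and> (\<exists>C. eps_correspondence \<epsilon> X Z C)}. ennreal \<gamma> \<le> ennreal \<epsilon> + ennreal \<delta>"
      using eps_correspondence_relcomp[OF assms] by (intro bexI[of _ "\<epsilon> + \<delta>"]) (auto, blast)
  qed
  then show ?thesis
    \<comment> \<open>The two halves on the right are gathered into a single quotient, leaving the
      inequality of the undivided infima.\<close>
    unfolding dGH_filtered_eq_INF add_divide_distrib_ennreal[symmetric]
    by (rule divide_right_mono_ennreal)
qed

theorem theorem8p15:
  fixes S :: "'a filtration set"
  assumes "\<And>X. X \<in> S \<Longrightarrow> R_filtration X"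
  shows "extended_pseudometric_on S dGH"
  \<comment> \<open>Each member of \<open>S\<close> enters \<open>dGH\<close> only through its
    filtered image, which is a filtered closure space.\<close>
  using dGH_filtered_refl dGH_filtered_triangle dGH_filtered_commute
    R_filtered_cspace_filtered_image[OF assms]
  unfolding extended_pseudometric_on_def dGH_def by blast

end
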